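(* Let $(H,d)$ be a Hadamard space. The following chain of inclusions holds: $\tau_M\subseteq\tau_w\subseteq\tau_K$. All three topologies coincide with the usual weak topology whenever $(H,d)$ is a Hilbert space.
   Context: A Hadamard space is a complete $\mathrm{CAT}(0)$ space; a Hilbert space is a Hadamard space with its norm metric. A set $C\subseteq H$ is convex if it contains the geodesic segment $[x,y]$ for all $x,y\in C$. For $x\in H$, $\Gamma_x(H)$ is the set of all constant speed geodesics $\gamma:[0,1]\to H$ (i.e. $d(\gamma(s),\gamma(t))=|s-t|\,d(\gamma(0),\gamma(1))$ for all $s,t\in[0,1]$) with $\gamma(0)=x$. For a geodesic $\gamma$, $P_\gamma$ denotes the metric projection onto (the image of) $\gamma$. Weak topology $\tau_w$: a set $U\subset H$ is weakly open if for every $x\in U$ there exist $\varepsilon>0$ and finitely many $\gamma_1,\dots,\gamma_n\in\Gamma_x(H)$ with $\{y\in H: d(x,P_{\gamma_i}y)<\varepsilon,\ i=1,\dots,n\}\subseteq U$. The weakly open sets (together with $\emptyset$) form the topology $\tau_w$. Monod's topology $\tau_M$: the weakest (coarsest) topology on $H$ such that every convex set that is closed in the metric topology is $\tau_M$-closed. Kakavandi's topology $\tau_K$: the topology on $H$ with subbasis $\{W(x,y;\varepsilon): x,y\in H,\ \varepsilon>0\}$, where $W(x,y;\varepsilon):=\{z\in H: |\langle\overrightarrow{xz},\overrightarrow{xy}\rangle|<\varepsilon\}$ and $\langle\overrightarrow{xz},\overrightarrow{xy}\rangle:=\tfrac12\big(d(x,z)^2+d(x,y)^2-d(z,y)^2\big)$.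 *)

theory Defs
  imports "HOL-Analysis.Analysis"
begin

text \<open>Constant speed geodesics are parametrised by the unit interval; as with library paths, the
  values of the function outside \<^term>\<open>{0..1::real}\<close> are irrelevant.\<close>

definition geodesic :: "(real \<Rightarrow> 'a::metric_space) \<Rightarrow> bool" where
  "geodesic \<gamma> \<longleftrightarrow>
     (\<forall>s\<in>{0..1}. \<forall>t\<in>{0..1}. dist (\<gamma> s) (\<gamma> t) = \<bar>s - t\<bar> * dist (\<gamma> 0) (\<gamma> 1))"

definition geodesics_from :: "'a::metric_space \<Rightarrow> (real \<Rightarrow> 'a) set" where
  "geodesics_from x = {\<gamma>. geodesic \<gamma> \<and> \<gamma> 0 = x}"

definition geodesic_space :: "'a::metric_space itself \<Rightarrow> bool" where
  "geodesic_space (T :: 'a itself) \<longleftrightarrow>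
     (\<forall>x y :: 'a. \<exists>\<gamma>. geodesic \<gamma> \<and> \<gamma> 0 = x \<and> \<gamma> 1 = y)"

text \<open>Geodesic triangles are at least as thin as their comparison triangles in the Euclidean plane.
  Two points on the same side have the same distance as their comparison points, and any two sides
  share a vertex, so (reversing a side if necessary) it suffices to compare points on two sides
  \<open>\<gamma>\<close>, \<open>\<eta>\<close> issuing from a common vertex. The points \<open>a\<close>, \<open>b\<close>, \<open>c\<close> form a comparison triangle.\<close>

definition CAT0 :: "'a::metric_space itself \<Rightarrow> bool" where
  "CAT0 (T :: 'a itself) \<longleftrightarrow>
     geodesic_space T \<and>
     (\<forall>(\<gamma> :: real \<Rightarrow> 'a) \<eta> (a :: real^2) b c.
        geodesic \<gamma> \<and> geodesic \<eta> \<and> \<gamma> 0 = \<eta> 0 \<and>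
        dist a b = dist (\<gamma> 0) (\<gamma> 1) \<and>
        dist a c = dist (\<eta> 0) (\<eta> 1) \<and>
        dist b c = dist (\<gamma> 1) (\<eta> 1) \<longrightarrow>
        (\<forall>s\<in>{0..1}. \<forall>t\<in>{0..1}.
           dist (\<gamma> s) (\<eta> t) \<le> dist ((1 - s) *\<^sub>R a + s *\<^sub>R b) ((1 - t) *\<^sub>R a + t *\<^sub>R c)))"

definition hadamard_space :: "'a::metric_space itself \<Rightarrow> bool" where
  "hadamard_space (T :: 'a itself) \<longleftrightarrow> complete (UNIV :: 'a set) \<and> CAT0 T"

text \<open>In a CAT(0) space the geodesic between two points is unique up to the values outside the unit
  interval, so quantifying over all geodesics amounts to speaking about the segment between them.\<close>

definition geodesically_convex :: "'a::metric_space set \<Rightarrow> bool" where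
  "geodesically_convex C \<longleftrightarrow>
     (\<forall>\<gamma>. geodesic \<gamma> \<and> \<gamma> 0 \<in> C \<and> \<gamma> 1 \<in> C \<longrightarrow> path_image \<gamma> \<subseteq> C)"

definition metric_projection :: "'a::metric_space set \<Rightarrow> 'a \<Rightarrow> 'a" where
  "metric_projection S y = (THE p. p \<in> S \<and> (\<forall>q\<in>S. dist y p \<le> dist y q))"

definition weakly_open :: "'a::metric_space set \<Rightarrow> bool" where
  "weakly_open U \<longleftrightarrow>
     (\<forall>x\<in>U. \<exists>\<epsilon>>0. \<exists>G. finite G \<and> G \<subseteq> geodesics_from x \<and>
        {y. \<forall>\<gamma>\<in>G. dist x (metric_projection (path_image \<gamma>) y) < \<epsilon>} \<subseteq> U)"

definition geodesic_weak_topology :: "'a::metric_space topology" where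
  "geodesic_weak_topology = topology weakly_open"

lemma istopology_weakly_open: "istopology weakly_open"
  unfolding istopology_def
proof (intro conjI allI impI)
  fix S T :: "'a set"
  assume S: "weakly_open S" and T: "weakly_open T"
  show "weakly_open (S \<inter> T)"
    unfolding weakly_open_def
  proof
    fix x assume x: "x \<in> S \<inter> T"
    let ?N = "\<lambda>\<epsilon> G. {y. \<forall>\<gamma>\<in>G. dist x (metric_projection (path_image \<gamma>) y) < \<epsilon>}"
    from S x obtain \<epsilon>1 G1
      where 1: "\<epsilon>1 > 0" "finite G1" "G1 \<subseteq> geodesics_from x" "?N \<epsilon>1 G1 \<subseteq> S"
      unfolding weakly_open_def by (meson IntD1 IntD2)
    from T x obtain \<epsilon>2 G2
      where 2: "\<epsilon>2 > 0" "finite G2" "G2 \<subseteq> geodesics_from x" "?N \<epsilon>2 G2 \<subseteq> T"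
      unfolding weakly_open_def by (meson IntD1 IntD2)
    have "?N (min \<epsilon>1 \<epsilon>2) (G1 \<union> G2) \<subseteq> ?N \<epsilon>1 G1 \<inter> ?N \<epsilon>2 G2"
      by (rule subsetI) simp
    also have "\<dots> \<subseteq> S \<inter> T"
      using 1(4) 2(4) by (rule Int_mono)
    finally have "?N (min \<epsilon>1 \<epsilon>2) (G1 \<union> G2) \<subseteq> S \<inter> T" .
    moreover have "min \<epsilon>1 \<epsilon>2 > 0" "finite (G1 \<union> G2)" "G1 \<union> G2 \<subseteq> geodesics_from x"
      using 1(1-3) 2(1-3) by simp_all
    ultimately show "\<exists>\<epsilon>>0. \<exists>G. finite G \<and> G \<subseteq> geodesics_from x \<and> ?N \<epsilon> G \<subseteq> S \<inter> T"
      by (intro exI conjI)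
  qed
next
  fix K :: "'a set set"
  assume K: "\<forall>S\<in>K. weakly_open S"
  show "weakly_open (\<Union>K)"
    unfolding weakly_open_def
  proof
    fix x assume "x \<in> \<Union>K"
    then obtain S where S: "S \<in> K" "x \<in> S" by (rule UnionE)
    let ?N = "\<lambda>\<epsilon> G. {y. \<forall>\<gamma>\<in>G. dist x (metric_projection (path_image \<gamma>) y) < \<epsilon>}"
    from K S(1) have "weakly_open S" by (rule bspec)
    from this S(2) obtain \<epsilon> G
      where G: "\<epsilon> > 0" "finite G" "G \<subseteq> geodesics_from x" "?N \<epsilon> G \<subseteq> S"
      unfolding weakly_open_def by meson
    from G(4) Union_upper[OF S(1)] have "?N \<epsilon> G \<subseteq> \<Union>K" by (rule subset_trans)
    with G(1-3) show "\<exists>\<epsilon>>0. \<exists>G. finite G \<and> G \<subseteq> geodesics_from x \<and> ?N \<epsilon> G \<subseteq> \<Union>K"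
      by (intro exI conjI)
  qed
qed

lemma openin_geodesic_weak_topology: "openin geodesic_weak_topology U \<longleftrightarrow> weakly_open U"
  unfolding geodesic_weak_topology_def topology_inverse'[OF istopology_weakly_open] ..

text \<open>Each of the generated topologies below has the whole space as its carrier.\<close>

definition monod_topology :: "'a::metric_space topology" where
  "monod_topology = topology_generated_by {- C | C :: 'a set. closed C \<and> geodesically_convex C}"

definition quasi_inner :: "'a::metric_space \<Rightarrow> 'a \<Rightarrow> 'a \<Rightarrow> real" where
  "quasi_inner x z y = ((dist x z)\<^sup>2 + (dist x y)\<^sup>2 - (dist z y)\<^sup>2) / 2"

definition kakavandi_topology :: "'a::metric_space topology" where
  "kakavandi_topology =
     topology_generated_by {{z. \<bar>quasi_inner x z y\<bar> < \<epsilon>} | (x :: 'a) y \<epsilon>. \<epsilon> > 0}"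

text \<open>The usual weak topology: the coarsest one making all bounded linear functionals continuous.\<close>

definition linear_weak_topology :: "'a::real_normed_vector topology" where
  "linear_weak_topology =
     topology_generated_by {f -` V | (f :: 'a \<Rightarrow> real) V. bounded_linear f \<and> open V}"

lemma topspace_weak_topologies:
  "topspace (geodesic_weak_topology :: 'a::metric_space topology) = UNIV"
  "topspace (monod_topology :: 'a topology) = UNIV"
  "topspace (kakavandi_topology :: 'a topology) = UNIV"
  "topspace (linear_weak_topology :: 'b::real_normed_vector topology) = UNIV"
proof -
  have Union_UNIV: "\<Union>S = UNIV" if "UNIV \<in> S" for S :: "'c set set"
    using that by (intro UNIV_eq_I [symmetric] UnionI [OF _ UNIV_I])
  have "weakly_open (UNIV :: 'a set)"
    unfolding weakly_open_def
    by (intro ballI exI[of _ "1::real"] conjI exI[of _ "{}"]) simp_all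
  then have "openin geodesic_weak_topology (UNIV :: 'a set)"
    by (simp only: openin_geodesic_weak_topology)
  then show "topspace (geodesic_weak_topology :: 'a topology) = UNIV"
    by (rule top.extremum_uniqueI [OF openin_subset])
  have "UNIV \<in> {- C | C :: 'a set. closed C \<and> geodesically_convex C}"
    by (intro CollectI exI[of _ "{}"]) (simp add: geodesically_convex_def)
  then show "topspace (monod_topology :: 'a topology) = UNIV"
    unfolding monod_topology_def topology_generated_by_topspace by (rule Union_UNIV)
  show "topspace (kakavandi_topology :: 'a topology) = UNIV"
    unfolding kakavandi_topology_def topology_generated_by_topspace
  proof (rule UNIV_eq_I [symmetric], rule UnionI)
    fix x :: 'a
    show "{z. \<bar>quasi_inner x z x\<bar> < 1} \<in>
        {{z. \<bar>quasi_inner x z y\<bar> < \<epsilon>} | x y \<epsilon>. \<epsilon> > 0}"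
      by (intro CollectI exI[of _ x] exI[of _ "1::real"]) simp
    show "x \<in> {z. \<bar>quasi_inner x z x\<bar> < 1}"
      by (simp add: quasi_inner_def)
  qed
  have "UNIV \<in> {f -` V | (f :: 'b \<Rightarrow> real) V. bounded_linear f \<and> open V}"
    by (intro CollectI exI[of _ "\<lambda>x. 0"] exI[of _ UNIV]) simp
  then show "topspace (linear_weak_topology :: 'b topology) = UNIV"
    unfolding linear_weak_topology_def topology_generated_by_topspace by (rule Union_UNIV)
qed

end

theory Submission imports Defs begin

text \<open>The metric input is a single inequality. Comparing a geodesic triangle with a planar one turns
  Stewart's identity into the statement that along a geodesic \<open>\<gamma>\<close> the squared distance
  \<open>f t = (dist y (\<gamma> t))\<^sup>2\<close> to a fixed point is as convex as in the plane (\<open>CAT0_stewart\<close>). If moreover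
  \<open>\<gamma> 1\<close> is the point of \<open>\<gamma>\<close> nearest to \<open>y\<close>, then
  \<open>f t + t * (dist (\<gamma> 0) (\<gamma> 1))\<^sup>2 \<le> f 0\<close> (\<open>nearest_endpoint\<close>); at \<open>t = 1\<close> this says that the angle at
  the foot of a perpendicular is not acute. Both inclusions are read off from it.

  Monod versus geodesics: let \<open>C\<close> be closed and convex, \<open>x \<notin> C\<close>, and let \<open>\<gamma>\<close> join \<open>x\<close> to its nearest
  point \<open>p\<close> in \<open>C\<close>. Every point of \<open>\<gamma>\<close> has \<open>p\<close> as nearest point in \<open>C\<close>, so by the angle
  condition every \<open>y \<in> C\<close> projects to \<open>p\<close> on \<open>\<gamma>\<close>. Hence the points \<open>y\<close> whose projection to \<open>\<gamma>\<close> is closer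
  to \<open>x\<close> than \<open>p\<close> form a basic weak neighbourhood of \<open>x\<close> that misses \<open>C\<close>.

  Geodesics versus Kakavandi: suppose that \<open>y\<close> projects on the geodesic \<open>\<gamma>\<close> from \<open>x\<close> to a point at
  distance at least \<open>\<epsilon>\<close> from \<open>x\<close>, and let \<open>q\<close> be the point of \<open>\<gamma>\<close> at distance \<open>\<epsilon>\<close> from \<open>x\<close>. Then
  \<open>nearest_endpoint\<close> gives \<open>quasi_inner x y q \<ge> \<epsilon>\<^sup>2\<close>. So the single Kakavandi set given by
  \<open>x\<close>, \<open>q\<close> and \<open>\<epsilon>\<^sup>2\<close> lies in the weak neighbourhood given by \<open>\<gamma>\<close> and \<open>\<epsilon>\<close>.

  A Hilbert space is a Hadamard space, because Stewart's identity forces geodesics to be affine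
  segments, and the distance between points on two sides of an affine triangle depends only on the
  side lengths. The chain of inclusions is then closed to a cycle: Kakavandi's subbasic sets are
  preimages of intervals under \<open>z \<mapsto> z \<bullet> (y - x)\<close>, hence linearly weakly open, and the preimage of
  an open interval under a bounded functional is the intersection of the complements of two closed
  convex sets (half-spaces, unless the functional is zero), hence
  open for Monod's topology.\<close>

section \<open>Stewart's identity and comparison\<close>

lemma stewart_identity:
  fixes a b p :: "'a::real_inner"
  shows "(dist p ((1 - t) *\<^sub>R a + t *\<^sub>R b))\<^sup>2 =
    (1 - t) * (dist p a)\<^sup>2 + t * (dist p b)\<^sup>2 - t * (1 - t) * (dist a b)\<^sup>2"
  unfolding dist_norm power2_norm_eq_inner
  by (simp add: inner_diff_left inner_diff_right inner_add_left inner_add_right inner_commute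
      algebra_simps power2_eq_square)

lemma comparison_triangle:
  fixes l m n :: real
  assumes "l \<ge> 0" "m \<ge> 0" "n \<ge> 0" "n \<le> l + m" "l \<le> m + n" "m \<le> l + n"
  obtains a b c :: "real^2" where "dist a b = l" "dist a c = m" "dist b c = n"
proof (cases "l = 0")
  case True
  then have "m = n" using assms by linarith
  show ?thesis
    by (rule that[of 0 0 "vector [m, 0]"])
      (use assms True \<open>m = n\<close> in \<open>simp_all add: dist_vec_def L2_set_def sum_2 dist_real_def\<close>)
next
  case False
  \<comment> \<open>Law of cosines, with the first side on the horizontal axis.\<close>
  define x where "x = (l\<^sup>2 + m\<^sup>2 - n\<^sup>2) / (2 * l)"
  have lx: "2 * l * x = l\<^sup>2 + m\<^sup>2 - n\<^sup>2" using False by (simp add: x_def)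
  have "\<bar>x\<bar> \<le> m"
  proof -
    have "n\<^sup>2 \<le> (l + m)\<^sup>2" using assms by (intro power_mono) auto
    moreover have "(l - m)\<^sup>2 \<le> n\<^sup>2" using assms by (simp add: abs_le_square_iff[symmetric])
    ultimately have "l * x \<le> l * m" "l * (- m) \<le> l * x"
      using lx by (auto simp: power2_eq_square algebra_simps)
    moreover have "l > 0" using False assms(1) by simp
    ultimately show ?thesis by (simp only: mult_le_cancel_left_pos abs_le_iff) simp
  qed
  then have "x\<^sup>2 \<le> m\<^sup>2" using assms(2) by (simp add: abs_le_square_iff[symmetric])
  then have s: "(sqrt (m\<^sup>2 - x\<^sup>2))\<^sup>2 = m\<^sup>2 - x\<^sup>2" by simp
  show ?thesis
  proof (rule that[of 0 "vector [l, 0]" "vector [x, sqrt (m\<^sup>2 - x\<^sup>2)]"])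
    show "dist (0::real^2) (vector [l, 0]) = l"
      using assms by (simp add: dist_vec_def L2_set_def sum_2 dist_real_def)
    show "dist (0::real^2) (vector [x, sqrt (m\<^sup>2 - x\<^sup>2)]) = m"
      using assms s by (simp add: dist_vec_def L2_set_def sum_2 dist_real_def)
    have "(l - x)\<^sup>2 + (m\<^sup>2 - x\<^sup>2) = n\<^sup>2"
      using lx by (simp add: power2_eq_square algebra_simps)
    then show "dist (vector [l, 0] :: real^2) (vector [x, sqrt (m\<^sup>2 - x\<^sup>2)]) = n"
      using assms s by (simp add: dist_vec_def L2_set_def sum_2 dist_real_def)
  qed
qed

lemma geodesic_dist:
  assumes "geodesic \<gamma>" "s \<in> {0..1}" "t \<in> {0..1}"
  shows "dist (\<gamma> s) (\<gamma> t) = \<bar>s - t\<bar> * dist (\<gamma> 0) (\<gamma> 1)"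
  using assms unfolding geodesic_def by blast

lemma convex_combination_in_unit_interval:
  fixes s u v :: real
  assumes "s \<in> {0..1}" "u \<in> {0..1}" "v \<in> {0..1}"
  shows "(1 - s) * u + s * v \<in> {0..1}"
  using convexD_alt[OF convex_real_interval(5)[of 0 1] assms(2,3), of s] assms(1) by simp

lemma geodesic_subsegment:
  assumes g: "geodesic \<gamma>" and u: "u \<in> {0..1}" and v: "v \<in> {0..1}"
  shows "geodesic (\<lambda>t. \<gamma> ((1 - t) * u + t * v))"
  unfolding geodesic_def
proof (intro ballI)
  fix s t :: real assume s: "s \<in> {0..1}" and t: "t \<in> {0..1}"
  have "((1 - s) * u + s * v) - ((1 - t) * u + t * v) = (s - t) * (v - u)"
    by (simp add: algebra_simps)
  then have "\<bar>((1 - s) * u + s * v) - ((1 - t) * u + t * v)\<bar> = \<bar>s - t\<bar> * \<bar>u - v\<bar>"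
    unfolding abs_minus_commute[of u v] by (simp only: abs_mult)
  then show "dist (\<gamma> ((1 - s) * u + s * v)) (\<gamma> ((1 - t) * u + t * v)) =
      \<bar>s - t\<bar> * dist (\<gamma> ((1 - 0) * u + 0 * v)) (\<gamma> ((1 - 1) * u + 1 * v))"
    using geodesic_dist[OF g convex_combination_in_unit_interval[OF s u v]
        convex_combination_in_unit_interval[OF t u v]] geodesic_dist[OF g u v]
    by (simp only: diff_zero diff_self mult_1 mult_zero_left add_0_left add_0_right mult.assoc)
qed

lemma geodesic_continuous_on:
  assumes "geodesic \<gamma>"
  shows "continuous_on {0..1} \<gamma>"
proof (rule lipschitz_on_continuous_on[of "dist (\<gamma> 0) (\<gamma> 1)"])
  show "(dist (\<gamma> 0) (\<gamma> 1))-lipschitz_on {0..1} \<gamma>"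
  proof (rule lipschitz_onI)
    fix s t :: real assume "s \<in> {0..1}" "t \<in> {0..1}"
    from geodesic_dist[OF assms this]
    show "dist (\<gamma> s) (\<gamma> t) \<le> dist (\<gamma> 0) (\<gamma> 1) * dist s t"
      by (simp only: dist_real_def mult.commute order_refl)
  qed simp
qed

lemma CAT0_geodesic:
  assumes "CAT0 TYPE('a::metric_space)"
  obtains \<gamma> where "geodesic \<gamma>" "\<gamma> 0 = (x::'a)" "\<gamma> 1 = y"
  using assms unfolding CAT0_def geodesic_space_def by blast

text \<open>The comparison is made for the triangle spanned by \<open>y\<close> and the ends of \<open>\<gamma>\<close>: the vertex opposite
  to \<open>\<gamma>\<close> is the end of a second side, so it is its own comparison point.\<close>

lemma CAT0_stewart:
  fixes \<gamma> :: "real \<Rightarrow> 'a::metric_space"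
  assumes C: "CAT0 TYPE('a)" and g: "geodesic \<gamma>" and t: "t \<in> {0..1}"
  shows "(dist y (\<gamma> t))\<^sup>2 \<le>
    (1 - t) * (dist y (\<gamma> 0))\<^sup>2 + t * (dist y (\<gamma> 1))\<^sup>2 - t * (1 - t) * (dist (\<gamma> 0) (\<gamma> 1))\<^sup>2"
proof -
  obtain \<eta> where e: "geodesic \<eta>" "\<eta> 0 = \<gamma> 0" "\<eta> 1 = y"
    using CAT0_geodesic[OF C] by metis
  obtain a b c :: "real^2" where abc: "dist a b = dist (\<gamma> 0) (\<gamma> 1)"
    "dist a c = dist (\<gamma> 0) y" "dist b c = dist (\<gamma> 1) y"
  proof (rule comparison_triangle)
    show "dist (\<gamma> 1) y \<le> dist (\<gamma> 0) (\<gamma> 1) + dist (\<gamma> 0) y"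
      by (rule dist_triangle3)
    show "dist (\<gamma> 0) (\<gamma> 1) \<le> dist (\<gamma> 0) y + dist (\<gamma> 1) y"
      by (rule dist_triangle2)
    show "dist (\<gamma> 0) y \<le> dist (\<gamma> 0) (\<gamma> 1) + dist (\<gamma> 1) y"
      by (rule dist_triangle)
  qed auto
  have *: "\<forall>s\<in>{0..1}. \<forall>t\<in>{0..1}.
      dist (\<gamma> s) (\<eta> t) \<le> dist ((1 - s) *\<^sub>R a + s *\<^sub>R b) ((1 - t) *\<^sub>R a + t *\<^sub>R c)"
    using C g e abc unfolding CAT0_def by metis
  have "dist (\<gamma> t) (\<eta> 1) \<le> dist ((1 - t) *\<^sub>R a + t *\<^sub>R b) c"
    using bspec[OF bspec[OF * t], of 1] by simp
  then have "(dist y (\<gamma> t))\<^sup>2 \<le> (dist c ((1 - t) *\<^sub>R a + t *\<^sub>R b))\<^sup>2"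
    using e(3) by (intro power_mono) (simp_all add: dist_commute)
  then show ?thesis
    unfolding stewart_identity using abc by (simp add: dist_commute)
qed

section \<open>Nearest points\<close>

text \<open>For \<open>t < 1\<close>, bound \<open>(dist y (\<gamma> 1))\<^sup>2\<close> in Stewart's inequality by \<open>(dist y (\<gamma> t))\<^sup>2\<close> and cancel
  the factor \<open>1 - t\<close>. The case \<open>t = 1\<close> is the limit.\<close>

lemma nearest_endpoint:
  fixes \<gamma> :: "real \<Rightarrow> 'a::metric_space"
  assumes C: "CAT0 TYPE('a)" and g: "geodesic \<gamma>" and t: "t \<in> {0..1}"
    and nearest: "\<And>s. s \<in> {0..1} \<Longrightarrow> dist y (\<gamma> 1) \<le> dist y (\<gamma> s)"
  shows "(dist y (\<gamma> t))\<^sup>2 + t * (dist (\<gamma> 0) (\<gamma> 1))\<^sup>2 \<le> (dist y (\<gamma> 0))\<^sup>2"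
proof -
  have sq: "(dist y (\<gamma> 1))\<^sup>2 \<le> (dist y (\<gamma> s))\<^sup>2" if "s \<in> {0..1}" for s
    using nearest[OF that] by (intro power_mono) auto
  have less1: "(dist y (\<gamma> s))\<^sup>2 + s * (dist (\<gamma> 0) (\<gamma> 1))\<^sup>2 \<le> (dist y (\<gamma> 0))\<^sup>2"
    if s: "s \<in> {0..1}" "s < 1" for s
  proof -
    have "s * (dist y (\<gamma> 1))\<^sup>2 \<le> s * (dist y (\<gamma> s))\<^sup>2"
      using sq[OF s(1)] s by (intro mult_left_mono) auto
    with CAT0_stewart[OF C g s(1), of y]
    have "(1 - s) * ((dist y (\<gamma> s))\<^sup>2 + s * (dist (\<gamma> 0) (\<gamma> 1))\<^sup>2) \<le> (1 - s) * (dist y (\<gamma> 0))\<^sup>2"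
      by (simp add: algebra_simps)
    then show ?thesis using s by simp
  qed
  show ?thesis
  proof (cases "t < 1")
    case True
    then show ?thesis using less1 t by blast
  next
    case False
    then have [simp]: "t = 1" using t by simp
    have "(dist (\<gamma> 0) (\<gamma> 1))\<^sup>2 \<le> (dist y (\<gamma> 0))\<^sup>2 - (dist y (\<gamma> 1))\<^sup>2"
    proof (rule field_le_mult_one_interval)
      fix s :: real assume "0 < s" "s < 1"
      then have "s \<in> {0..1}" "s < 1" by simp_all
      from less1[OF this] sq[OF this(1)] show "s * (dist (\<gamma> 0) (\<gamma> 1))\<^sup>2 \<le> (dist y (\<gamma> 0))\<^sup>2 - (dist y (\<gamma> 1))\<^sup>2"
        by linarith
    qed
    then show ?thesis by simp
  qed
qed

lemma metric_projection_geodesic: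
  fixes \<gamma> :: "real \<Rightarrow> 'a::metric_space"
  assumes C: "CAT0 TYPE('a)" and g: "geodesic \<gamma>" and u: "u \<in> {0..1}"
    and nearest: "\<And>s. s \<in> {0..1} \<Longrightarrow> dist y (\<gamma> u) \<le> dist y (\<gamma> s)"
  shows "metric_projection (path_image \<gamma>) y = \<gamma> u"
  unfolding metric_projection_def
proof (rule the_equality)
  show "\<gamma> u \<in> path_image \<gamma> \<and> (\<forall>q\<in>path_image \<gamma>. dist y (\<gamma> u) \<le> dist y q)"
    using u nearest by (auto simp: path_image_def)
next
  fix p assume p: "p \<in> path_image \<gamma> \<and> (\<forall>q\<in>path_image \<gamma>. dist y p \<le> dist y q)"
  then obtain v where v: "v \<in> {0..1}" "p = \<gamma> v" by (auto simp: path_image_def)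
  then have "dist y (\<gamma> v) \<le> dist y (\<gamma> u)" using p u by (auto simp: path_image_def)
  then have eq: "dist y (\<gamma> v) = dist y (\<gamma> u)" using nearest[OF v(1)] by simp
  have "(dist y (\<gamma> u))\<^sup>2 + (dist (\<gamma> v) (\<gamma> u))\<^sup>2 \<le> (dist y (\<gamma> v))\<^sup>2"
    using nearest_endpoint[OF C geodesic_subsegment[OF g v(1) u], of 1 y]
      nearest[OF convex_combination_in_unit_interval[OF _ v(1) u]] by simp
  then show "p = \<gamma> u" using eq v(2) by simp
qed

lemma nearest_point_on_geodesic:
  fixes \<gamma> :: "real \<Rightarrow> 'a::metric_space"
  assumes "geodesic \<gamma>"
  obtains u where "u \<in> {0..1}" "\<And>s. s \<in> {0..1} \<Longrightarrow> dist y (\<gamma> u) \<le> dist y (\<gamma> s)"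
proof -
  have "continuous_on {0..1::real} (\<lambda>s. dist y (\<gamma> s))"
    by (intro continuous_on_dist continuous_on_const geodesic_continuous_on assms)
  from continuous_attains_inf[OF _ _ this] that show thesis by auto
qed

text \<open>A minimising sequence is Cauchy, because the midpoint of two of its members belongs to \<open>C\<close> and
  would be too close to \<open>x\<close> if the two were far apart.\<close>

lemma hadamard_nearest_point:
  fixes C :: "'a::metric_space set"
  assumes H: "hadamard_space TYPE('a)" and C: "closed C" "geodesically_convex C" "C \<noteq> {}"
  obtains p where "p \<in> C" "\<And>q. q \<in> C \<Longrightarrow> dist x p \<le> dist x q"
proof -
  have CAT: "CAT0 TYPE('a)" using H by (simp add: hadamard_space_def)
  define r where "r = infdist x C"
  have r: "0 \<le> r" "\<And>q. q \<in> C \<Longrightarrow> r \<le> dist x q"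
    by (simp_all add: r_def infdist_nonneg infdist_le)
  have "\<exists>c\<in>C. (dist x c)\<^sup>2 < r\<^sup>2 + 1 / real (Suc n)" for n
  proof -
    have "r < sqrt (r\<^sup>2 + 1 / real (Suc n))" by (intro real_less_rsqrt) simp
    then have "(INF q\<in>C. dist x q) < sqrt (r\<^sup>2 + 1 / real (Suc n))"
      using C(3) by (simp add: r_def infdist_def)
    then obtain c where c: "c \<in> C" "dist x c < sqrt (r\<^sup>2 + 1 / real (Suc n))"
      using cINF_less_iff[OF C(3), of "dist x"] bdd_belowI2[of C 0 "dist x"] by auto
    then have "(dist x c)\<^sup>2 < (sqrt (r\<^sup>2 + 1 / real (Suc n)))\<^sup>2"
      by (intro power_strict_mono) auto
    then show ?thesis using c(1) by (intro bexI[of _ c]) simp_all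
  qed
  then obtain c where c: "\<And>n. c n \<in> C" "\<And>n. (dist x (c n))\<^sup>2 < r\<^sup>2 + 1 / real (Suc n)"
    by metis
  have mid: "(dist (c m) (c n))\<^sup>2 < 2 * (1 / real (Suc m) + 1 / real (Suc n))" for m n
  proof -
    obtain \<gamma> where g: "geodesic \<gamma>" "\<gamma> 0 = c m" "\<gamma> 1 = c n"
      using CAT0_geodesic[OF CAT] by metis
    have "\<gamma> (1/2) \<in> C" using C(2) g c(1) by (force simp: geodesically_convex_def path_image_def)
    then have "r\<^sup>2 \<le> (dist x (\<gamma> (1/2)))\<^sup>2" using r by (intro power_mono) auto
    moreover have "(dist x (\<gamma> (1/2)))\<^sup>2 \<le> (1 - 1/2) * (dist x (c m))\<^sup>2 + 1/2 * (dist x (c n))\<^sup>2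
        - 1/2 * (1 - 1/2) * (dist (c m) (c n))\<^sup>2"
      using CAT0_stewart[OF CAT g(1), of "1/2" x] g by simp
    ultimately show ?thesis using c(2)[of m] c(2)[of n] by argo
  qed
  have "Cauchy c"
  proof (rule metric_CauchyI)
    fix e :: real assume e: "0 < e"
    obtain N where N: "1 / real (Suc N) < e\<^sup>2 / 4"
      using nat_approx_posE[of "e\<^sup>2 / 4"] e by auto
    have "dist (c m) (c n) < e" if mn: "m \<ge> N" "n \<ge> N" for m n
    proof -
      have "1 / real (Suc m) \<le> 1 / real (Suc N)" "1 / real (Suc n) \<le> 1 / real (Suc N)"
        using mn by (auto intro!: divide_left_mono)
      then have "(dist (c m) (c n))\<^sup>2 < e\<^sup>2" using mid[of m n] N by argo
      then show ?thesis using e by (simp add: power_less_imp_less_base)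
    qed
    then show "\<exists>M. \<forall>m\<ge>M. \<forall>n\<ge>M. dist (c m) (c n) < e" by blast
  qed
  then obtain p where p: "c \<longlonglongrightarrow> p"
    using H unfolding hadamard_space_def complete_def by blast
  have "p \<in> C" using closed_sequentially[OF C(1) c(1) p] .
  moreover have "(dist x p)\<^sup>2 \<le> r\<^sup>2"
  proof (rule LIMSEQ_le)
    show "(\<lambda>n. (dist x (c n))\<^sup>2) \<longlonglongrightarrow> (dist x p)\<^sup>2" by (intro tendsto_intros p)
    show "(\<lambda>n. r\<^sup>2 + 1 / real (Suc n)) \<longlonglongrightarrow> r\<^sup>2"
      using tendsto_add[OF tendsto_const LIMSEQ_inverse_real_of_nat, of "r\<^sup>2"]
      by (simp add: inverse_eq_divide)
    show "\<exists>N. \<forall>n\<ge>N. (dist x (c n))\<^sup>2 \<le> r\<^sup>2 + 1 / real (Suc n)"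
      using c(2) by (blast intro: less_imp_le)
  qed
  then have "dist x p \<le> r" using r(1) by (rule power2_le_imp_le)
  ultimately show thesis using that r(2) by (meson order_trans)
qed

section \<open>The chain of inclusions\<close>

lemma weakly_open_Compl_closed_convex:
  fixes C :: "'a::metric_space set"
  assumes H: "hadamard_space TYPE('a)" and C: "closed C" "geodesically_convex C"
  shows "weakly_open (- C)"
proof (cases "C = {}")
  case True
  then show ?thesis
    using openin_topspace[of "geodesic_weak_topology :: 'a topology"]
    by (simp add: openin_geodesic_weak_topology topspace_weak_topologies)
next
  case False
  have CAT: "CAT0 TYPE('a)" using H by (simp add: hadamard_space_def)
  show ?thesis
    unfolding weakly_open_def
  proof
    fix x assume x: "x \<in> - C"
    obtain p where p: "p \<in> C" "\<And>q. q \<in> C \<Longrightarrow> dist x p \<le> dist x q"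
      using hadamard_nearest_point[OF H C False] by metis
    obtain \<gamma> where g: "geodesic \<gamma>" "\<gamma> 0 = x" "\<gamma> 1 = p" using CAT0_geodesic[OF CAT] by metis
    have proj: "metric_projection (path_image \<gamma>) y = p" if y: "y \<in> C" for y
    proof -
      have "dist y (\<gamma> 1) \<le> dist y (\<gamma> s)" if s: "s \<in> {0..1}" for s
      proof -
        have split: "dist x p = dist x (\<gamma> s) + dist (\<gamma> s) p"
          using geodesic_dist[OF g(1), of 0 s] geodesic_dist[OF g(1) s, of 1] s g
          by (simp add: algebra_simps)
        \<comment> \<open>A point of \<open>C\<close> closer to \<open>\<gamma> s\<close> than \<open>p\<close> would be closer to \<open>x\<close> as well.\<close>
        have near: "dist (\<gamma> s) p \<le> dist (\<gamma> s) q" if "q \<in> C" for q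
          using split p(2)[OF that] dist_triangle[of x q "\<gamma> s"] by linarith
        obtain \<eta> where e: "geodesic \<eta>" "\<eta> 0 = y" "\<eta> 1 = p" using CAT0_geodesic[OF CAT] by metis
        have "\<eta> r \<in> C" if "r \<in> {0..1}" for r
          using that C(2) e p(1) y unfolding geodesically_convex_def path_image_def by blast
        then have "(dist (\<gamma> s) p)\<^sup>2 + (dist y p)\<^sup>2 \<le> (dist (\<gamma> s) y)\<^sup>2"
          using nearest_endpoint[OF CAT e(1), of 1 "\<gamma> s"] near e by simp
        then have "(dist y p)\<^sup>2 \<le> (dist y (\<gamma> s))\<^sup>2"
          using zero_le_power2[of "dist (\<gamma> s) p"] unfolding dist_commute[of "\<gamma> s" y] by linarith
        then show ?thesis unfolding g(3) by (rule power2_le_imp_le) simp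
      qed
      then show ?thesis using metric_projection_geodesic[OF CAT g(1), of 1 y] g(3) by simp
    qed
    show "\<exists>\<epsilon>>0. \<exists>G. finite G \<and> G \<subseteq> geodesics_from x \<and>
        {y. \<forall>\<gamma>\<in>G. dist x (metric_projection (path_image \<gamma>) y) < \<epsilon>} \<subseteq> - C"
    proof (intro exI[of _ "dist x p"] exI[of _ "{\<gamma>}"] conjI)
      show "dist x p > 0" using x p(1) by auto
    qed (use g proj in \<open>auto simp: geodesics_from_def\<close>)
  qed
qed

lemma quasi_inner_neighbourhood:
  fixes \<gamma> :: "real \<Rightarrow> 'a::metric_space"
  assumes C: "CAT0 TYPE('a)" and g: "\<gamma> \<in> geodesics_from x" and \<epsilon>: "\<epsilon> > 0"
  obtains q where
    "\<And>y. \<bar>quasi_inner x y q\<bar> < \<epsilon>\<^sup>2 \<Longrightarrow> dist x (metric_projection (path_image \<gamma>) y) < \<epsilon>"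
proof -
  define L where "L = dist x (\<gamma> 1)"
  have geo: "geodesic \<gamma>" and g0: "\<gamma> 0 = x" using g by (auto simp: geodesics_from_def)
  have dist_x: "dist x (\<gamma> s) = s * L" if "s \<in> {0..1}" for s
    using geodesic_dist[OF geo, of 0 s] that g0 by (simp add: L_def)
  \<comment> \<open>The point at distance \<open>\<epsilon>\<close> from \<open>x\<close> if \<open>\<epsilon> \<le> L\<close>. If \<open>L < \<epsilon>\<close>, any point would do, since then
    every projection is within distance \<open>\<epsilon>\<close> of \<open>x\<close>.\<close>
  define q where "q = \<gamma> (\<epsilon> / L)"
  have "dist x (metric_projection (path_image \<gamma>) y) < \<epsilon>" if y: "\<bar>quasi_inner x y q\<bar> < \<epsilon>\<^sup>2" for y
  proof -
    obtain u where u: "u \<in> {0..1}" "\<And>s. s \<in> {0..1} \<Longrightarrow> dist y (\<gamma> u) \<le> dist y (\<gamma> s)"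
      using nearest_point_on_geodesic[OF geo] by metis
    have proj: "metric_projection (path_image \<gamma>) y = \<gamma> u"
      by (rule metric_projection_geodesic[OF C geo u])
    have "u * L < \<epsilon>"
    proof (rule ccontr)
      assume "\<not> u * L < \<epsilon>"
      then have uL: "\<epsilon> \<le> u * L" by simp
      have "L \<ge> 0" by (simp add: L_def)
      then have "u > 0" "L > 0" using uL u(1) \<epsilon> by (auto simp: less_le)
      define t where "t = \<epsilon> / (u * L)"
      have t: "t \<in> {0..1}" using uL \<epsilon> by (auto simp: t_def divide_simps)
      have tu: "t * u = \<epsilon> / L" using \<open>u > 0\<close> by (simp add: t_def)
      have "(dist y (\<gamma> (t * u)))\<^sup>2 + t * (dist x (\<gamma> u))\<^sup>2 \<le> (dist y x)\<^sup>2"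
        using nearest_endpoint[OF C geodesic_subsegment[OF geo _ u(1), of 0] t, of y]
          u(2)[OF convex_combination_in_unit_interval[OF _ _ u(1), of _ 0]] g0 by simp
      then have "(dist y q)\<^sup>2 + \<epsilon> * (u * L) \<le> (dist y x)\<^sup>2"
        using dist_x[OF u(1)] \<open>u > 0\<close> \<open>L > 0\<close>
        by (simp add: tu q_def t_def power2_eq_square)
      moreover have "\<epsilon>\<^sup>2 \<le> \<epsilon> * (u * L)" using uL \<epsilon> by (simp add: power2_eq_square)
      moreover have "dist x q = \<epsilon>"
        using dist_x[OF convex_combination_in_unit_interval[OF t _ u(1), of 0]] \<open>L > 0\<close>
        by (simp add: tu q_def)
      ultimately have "quasi_inner x y q \<ge> \<epsilon>\<^sup>2"
        by (simp add: quasi_inner_def dist_commute)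
      then show False using y by simp
    qed
    then show ?thesis using proj dist_x[OF u(1)] by simp
  qed
  then show thesis by (rule that)
qed

lemma monod_le_weak:
  assumes H: "hadamard_space TYPE('a::metric_space)" and U: "openin monod_topology (U :: 'a set)"
  shows "openin geodesic_weak_topology U"
proof -
  have "generate_topology_on {- C | C :: 'a set. closed C \<and> geodesically_convex C} U"
    using U by (simp add: monod_topology_def openin_topology_generated_by_iff)
  then have "weakly_open U"
    by (rule generate_topology_on_coarsest[OF istopology_weakly_open, rotated])
      (use weakly_open_Compl_closed_convex[OF H] in auto)
  then show ?thesis by (simp add: openin_geodesic_weak_topology)
qed

lemma weak_le_kakavandi:
  assumes H: "hadamard_space TYPE('a::metric_space)"
    and U: "openin geodesic_weak_topology (U :: 'a set)"
  shows "openin kakavandi_topology U"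
proof (subst openin_subopen, rule ballI)
  fix x assume x: "x \<in> U"
  have CAT: "CAT0 TYPE('a)" using H by (simp add: hadamard_space_def)
  have "weakly_open U" using U by (simp add: openin_geodesic_weak_topology)
  with x obtain \<epsilon> G where G: "\<epsilon> > 0" "finite G" "G \<subseteq> geodesics_from x"
    "{y. \<forall>\<gamma>\<in>G. dist x (metric_projection (path_image \<gamma>) y) < \<epsilon>} \<subseteq> U"
    unfolding weakly_open_def by meson
  have "\<exists>q. \<forall>y. \<bar>quasi_inner x y q\<bar> < \<epsilon>\<^sup>2 \<longrightarrow>
      dist x (metric_projection (path_image \<gamma>) y) < \<epsilon>" if "\<gamma> \<in> G" for \<gamma>
  proof -
    have "\<gamma> \<in> geodesics_from x" using that G(3) by blast
    from quasi_inner_neighbourhood[OF CAT this G(1)] show ?thesis by blast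
  qed
  then obtain q where q: "\<And>\<gamma> y. \<gamma> \<in> G \<Longrightarrow> \<bar>quasi_inner x y (q \<gamma>)\<bar> < \<epsilon>\<^sup>2 \<Longrightarrow>
      dist x (metric_projection (path_image \<gamma>) y) < \<epsilon>"
    by metis
  let ?W = "\<lambda>\<gamma>. {y. \<bar>quasi_inner x y (q \<gamma>)\<bar> < \<epsilon>\<^sup>2}"
  \<comment> \<open>Adjoining \<open>UNIV\<close> covers the case of an empty family \<open>G\<close>.\<close>
  have "openin kakavandi_topology (\<Inter>(insert UNIV (?W ` G)))"
  proof (rule openin_Inter)
    fix V assume "V \<in> insert UNIV (?W ` G)"
    then consider "V = UNIV" | \<gamma> where "V = ?W \<gamma>" by blast
    then show "openin kakavandi_topology V"
    proof cases
      case 1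
      then show ?thesis
        using openin_topspace[of "kakavandi_topology :: 'a topology"]
        by (simp add: topspace_weak_topologies)
    next
      case 2
      then show ?thesis
        unfolding kakavandi_topology_def using zero_less_power[OF G(1), of 2]
        by (intro topology_generated_by_Basis) blast
    qed
  qed (use G in auto)
  moreover have "x \<in> \<Inter>(insert UNIV (?W ` G))" using G(1) by (auto simp: quasi_inner_def)
  moreover have "\<Inter>(insert UNIV (?W ` G)) \<subseteq> U" using q G(4) by auto
  ultimately show "\<exists>T. openin kakavandi_topology T \<and> x \<in> T \<and> T \<subseteq> U" by blast
qed

section \<open>Hilbert spaces\<close>

text \<open>The point \<open>\<gamma> t\<close> divides the distance between the ends of \<open>\<gamma>\<close> in the same ratio as the affine
  combination does, and Stewart's identity then gives distance zero between the two.\<close>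

lemma geodesic_eq_affine_segment:
  fixes \<gamma> :: "real \<Rightarrow> 'a::real_inner"
  assumes g: "geodesic \<gamma>" and t: "t \<in> {0..1}"
  shows "\<gamma> t = (1 - t) *\<^sub>R \<gamma> 0 + t *\<^sub>R \<gamma> 1"
proof -
  have d: "dist (\<gamma> t) (\<gamma> 0) = t * dist (\<gamma> 0) (\<gamma> 1)"
    "dist (\<gamma> t) (\<gamma> 1) = (1 - t) * dist (\<gamma> 0) (\<gamma> 1)"
    using geodesic_dist[OF g t, of 0] geodesic_dist[OF g t, of 1] t by auto
  have "(dist (\<gamma> t) ((1 - t) *\<^sub>R \<gamma> 0 + t *\<^sub>R \<gamma> 1))\<^sup>2 = 0"
    unfolding stewart_identity d by (simp add: power2_eq_square algebra_simps)
  then show ?thesis by simp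
qed

lemma geodesic_affine_segment:
  fixes a b :: "'a::real_normed_vector"
  shows "geodesic (\<lambda>t. (1 - t) *\<^sub>R a + t *\<^sub>R b)"
  unfolding geodesic_def
proof (intro ballI)
  fix s t :: real
  have "((1 - s) *\<^sub>R a + s *\<^sub>R b) - ((1 - t) *\<^sub>R a + t *\<^sub>R b) = (t - s) *\<^sub>R (a - b)"
    by (simp add: algebra_simps)
  then show "dist ((1 - s) *\<^sub>R a + s *\<^sub>R b) ((1 - t) *\<^sub>R a + t *\<^sub>R b) =
      \<bar>s - t\<bar> * dist ((1 - 0) *\<^sub>R a + 0 *\<^sub>R b) ((1 - 1) *\<^sub>R a + 1 *\<^sub>R b)"
    by (simp add: dist_norm abs_minus_commute)
qed

text \<open>The distance between points on two sides is a function of the three side lengths alone, so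
  in an inner product space comparison holds with equality.\<close>

lemma dist_between_sides:
  fixes a b c :: "'a::real_inner"
  shows "(dist ((1 - s) *\<^sub>R a + s *\<^sub>R b) ((1 - t) *\<^sub>R a + t *\<^sub>R c))\<^sup>2 =
    s\<^sup>2 * (dist a b)\<^sup>2 + t\<^sup>2 * (dist a c)\<^sup>2 - s * t * ((dist a b)\<^sup>2 + (dist a c)\<^sup>2 - (dist b c)\<^sup>2)"
  unfolding dist_norm power2_norm_eq_inner
  by (simp add: inner_diff_left inner_diff_right inner_add_left inner_add_right inner_commute
      algebra_simps power2_eq_square)

lemma real_inner_CAT0: "CAT0 TYPE('a::real_inner)"
  unfolding CAT0_def
proof (intro conjI allI impI ballI)
  show "geodesic_space TYPE('a)"
    unfolding geodesic_space_def
  proof (intro allI)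
    fix x y :: 'a
    show "\<exists>\<gamma>. geodesic \<gamma> \<and> \<gamma> 0 = x \<and> \<gamma> 1 = y"
      using geodesic_affine_segment[of x y]
      by (intro exI[of _ "\<lambda>t. (1 - t) *\<^sub>R x + t *\<^sub>R y"]) simp
  qed
next
  fix \<gamma> \<eta> :: "real \<Rightarrow> 'a" and a b c :: "real^2" and s t :: real
  assume h: "geodesic \<gamma> \<and> geodesic \<eta> \<and> \<gamma> 0 = \<eta> 0 \<and>
        dist a b = dist (\<gamma> 0) (\<gamma> 1) \<and> dist a c = dist (\<eta> 0) (\<eta> 1) \<and>
        dist b c = dist (\<gamma> 1) (\<eta> 1)"
    and s: "s \<in> {0..1}" and t: "t \<in> {0..1}"
  have "\<gamma> s = (1 - s) *\<^sub>R \<gamma> 0 + s *\<^sub>R \<gamma> 1" "\<eta> t = (1 - t) *\<^sub>R \<gamma> 0 + t *\<^sub>R \<eta> 1"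
    using h geodesic_eq_affine_segment[OF _ s, of \<gamma>] geodesic_eq_affine_segment[OF _ t, of \<eta>]
    by simp_all
  then have "(dist (\<gamma> s) (\<eta> t))\<^sup>2 =
      (dist ((1 - s) *\<^sub>R a + s *\<^sub>R b) ((1 - t) *\<^sub>R a + t *\<^sub>R c))\<^sup>2"
    using h by (simp only: dist_between_sides)
  then show "dist (\<gamma> s) (\<eta> t) \<le> dist ((1 - s) *\<^sub>R a + s *\<^sub>R b) ((1 - t) *\<^sub>R a + t *\<^sub>R c)"
    by (simp add: power2_eq_iff_nonneg)
qed

lemma hilbert_hadamard_space: "hadamard_space TYPE('a::{real_inner, complete_space})"
  by (simp add: hadamard_space_def real_inner_CAT0 complete_UNIV)

lemma quasi_inner_eq_inner:
  fixes x y z :: "'a::real_inner"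
  shows "quasi_inner x z y = z \<bullet> (y - x) - x \<bullet> (y - x)"
  unfolding quasi_inner_def dist_norm power2_norm_eq_inner
  by (simp add: inner_diff_left inner_diff_right inner_commute field_simps)

lemma kakavandi_le_linear:
  fixes U :: "'a::real_inner set"
  assumes U: "openin kakavandi_topology U"
  shows "openin linear_weak_topology U"
proof -
  have "generate_topology_on {{z. \<bar>quasi_inner x z y\<bar> < \<epsilon>} | (x :: 'a) y \<epsilon>. \<epsilon> > 0} U"
    using U by (simp add: kakavandi_topology_def openin_topology_generated_by_iff)
  then show ?thesis
  proof (rule generate_topology_on_coarsest[OF istopology_openin, rotated])
    fix W assume "W \<in> {{z. \<bar>quasi_inner x z y\<bar> < \<epsilon>} | (x :: 'a) y \<epsilon>. \<epsilon> > 0}"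
    then obtain x y \<epsilon> where W: "W = {z. \<bar>quasi_inner x z y\<bar> < \<epsilon>}" by blast
    have "W = (\<lambda>z. z \<bullet> (y - x)) -` ball (x \<bullet> (y - x)) \<epsilon>"
      by (auto simp: W quasi_inner_eq_inner dist_real_def)
    then show "openin linear_weak_topology W"
      unfolding linear_weak_topology_def
      by (intro topology_generated_by_Basis) (auto intro: bounded_linear_inner_left)
  qed
qed

lemma convex_imp_geodesically_convex:
  fixes C :: "'a::real_inner set"
  assumes "convex C"
  shows "geodesically_convex C"
  unfolding geodesically_convex_def
proof (intro allI impI subsetI)
  fix \<gamma> :: "real \<Rightarrow> 'a" and z
  assume h: "geodesic \<gamma> \<and> \<gamma> 0 \<in> C \<and> \<gamma> 1 \<in> C" and "z \<in> path_image \<gamma>"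
  then obtain t where t: "t \<in> {0..1}" "z = \<gamma> t" by (auto simp: path_image_def)
  then show "z \<in> C"
    using h geodesic_eq_affine_segment[of \<gamma> t] convexD_alt[OF assms, of "\<gamma> 0" "\<gamma> 1" t] by simp
qed

lemma linear_le_monod:
  fixes U :: "'a::real_inner set"
  assumes U: "openin linear_weak_topology U"
  shows "openin monod_topology U"
proof -
  have half_space: "openin monod_topology (- {z. f z \<le> a})"
    if f: "bounded_linear f" for f :: "'a \<Rightarrow> real" and a
  proof -
    have "closed {z. f z \<le> a}"
      by (intro closed_Collect_le continuous_on_const linear_continuous_on f)
    moreover have "convex (f -` {..a})"
      by (rule convex_linear_vimage) (use f in \<open>auto simp: bounded_linear.linear\<close>)
    then have "geodesically_convex {z. f z \<le> a}"
      by (intro convex_imp_geodesically_convex) (simp add: vimage_def)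
    ultimately show ?thesis
      unfolding monod_topology_def by (intro topology_generated_by_Basis) blast
  qed
  have "generate_topology_on {f -` V | (f :: 'a \<Rightarrow> real) V. bounded_linear f \<and> open V} U"
    using U by (simp add: linear_weak_topology_def openin_topology_generated_by_iff)
  then show ?thesis
  proof (rule generate_topology_on_coarsest[OF istopology_openin, rotated])
    fix W assume "W \<in> {f -` V | (f :: 'a \<Rightarrow> real) V. bounded_linear f \<and> open V}"
    then obtain f :: "'a \<Rightarrow> real" and V where W: "W = f -` V" "bounded_linear f" "open V"
      by blast
    show "openin monod_topology W"
    proof (subst openin_subopen, rule ballI)
      fix x assume "x \<in> W"
      then obtain e where e: "e > 0" "ball (f x) e \<subseteq> V"
        using W open_contains_ball by (metis vimageE)
      let ?T = "- {z. f z \<le> f x - e} \<inter> - {z. - f z \<le> - f x - e}"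
      have "openin monod_topology ?T"
        using W(2) by (intro openin_Int half_space bounded_linear_minus)
      moreover have "x \<in> ?T" using e by simp
      moreover have "?T \<subseteq> W"
      proof
        fix z assume "z \<in> ?T"
        then have "f z \<in> ball (f x) e" by (auto simp: dist_real_def abs_less_iff)
        then show "z \<in> W" using e(2) W(1) by blast
      qed
      ultimately show "\<exists>T. openin monod_topology T \<and> x \<in> T \<and> T \<subseteq> W" by blast
    qed
  qed
qed

theorem proposition16:
  "(hadamard_space TYPE('a::metric_space) \<longrightarrow>
      {U :: 'a set. openin monod_topology U} \<subseteq> {U. openin geodesic_weak_topology U} \<and>
      {U :: 'a set. openin geodesic_weak_topology U} \<subseteq> {U. openin kakavandi_topology U}) \<and>
   (monod_topology :: 'b::{real_inner, complete_space} topology) = linear_weak_topology \<and>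
   (geodesic_weak_topology :: 'b topology) = linear_weak_topology \<and>
   (kakavandi_topology :: 'b topology) = linear_weak_topology"
proof -
  have cycle: "openin monod_topology U \<Longrightarrow> openin geodesic_weak_topology U"
    "openin geodesic_weak_topology U \<Longrightarrow> openin kakavandi_topology U"
    "openin kakavandi_topology U \<Longrightarrow> openin linear_weak_topology U"
    "openin linear_weak_topology U \<Longrightarrow> openin monod_topology U" for U :: "'b set"
    by (rule monod_le_weak[OF hilbert_hadamard_space] weak_le_kakavandi[OF hilbert_hadamard_space]
        kakavandi_le_linear linear_le_monod; assumption)+
  show ?thesis
    unfolding topology_eq
    using monod_le_weak weak_le_kakavandi cycle by blast
qed

end
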